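(* Let $A\in\mathbb{N}^{d\times n}$ have no zero columns and let $B\in\mathbb{N}^{p\times n}$. Then the Markov complexity $m(A,B)$ is bounded below by the maximum $1$-norm of any element in the Graver basis $\mathcal{G}(B\cdot\mathcal{S}(A))$.
   Context: $\mathbb{N}=\{0,1,2,\ldots\}$. For an integer matrix $A$ with $n$ columns, $\ker_{\mathbb{Z}}(A)=\{\mathbf{u}\in\mathbb{Z}^n: A\mathbf{u}=0\}$. For nonzero $\mathbf{u},\mathbf{v},\mathbf{v}'\in\ker_{\mathbb{Z}}(A)$, the equation $\mathbf{u}=\mathbf{v}+\mathbf{v}'$ is a semi-conformal decomposition of $\mathbf{u}$ if for all $1\le i\le n$: $v_i>0$ implies $v_i\le u_i$, and $v_i'<0$ implies $u_i\le v_i'$. $\mathcal{S}(A)$ is the set of nonzero vectors in $\ker_{\mathbb{Z}}(A)$ that have no semi-conformal decomposition. $B\cdot\mathcal{S}(A)$ is the $p\times|\mathcal{S}(A)|$ matrix whose columns are the vectors $B\mathbf{v}$, one for each $\mathbf{v}\in\mathcal{S}(A)$. For nonzero $\mathbf{u},\mathbf{v},\mathbf{v}'\in\ker_{\mathbb{Z}}(A)$, $\mathbf{u}=\mathbf{v}+\mathbf{v}'$ is a conformal decomposition if for all $i$: $u_i\ge0$ implies $0\le v_i,v_i'\le u_i$, and $u_i\le0$ implies $u_i\le v_i,v_i'\le0$. The Graver basis $\mathcal{G}(C)$ of an integer matrix $C$ is the set of nonzero vectors in $\ker_{\mathbb{Z}}(C)$ having no conformal decomposition (with respect to $\ker_{\mathbb{Z}}(C)$);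 it is finite. For a matrix $C$ with nonnegative integer entries, $N$ columns and no zero column, a finite set $\mathcal{M}\subset\ker_{\mathbb{Z}}(C)$ is a Markov basis of $C$ if for any $\mathbf{t},\mathbf{u}\in\mathbb{N}^N$ with $C\mathbf{t}=C\mathbf{u}$ there is a finite sequence $\mathbf{v}_1,\ldots,\mathbf{v}_s$ of elements of $\mathcal{M}$ with $\mathbf{t}+\sum_{i=1}^p\mathbf{v}_i\ge0$ for all $1\le p\le s$ and $\mathbf{t}+\sum_{i=1}^s\mathbf{v}_i=\mathbf{u}$. It is minimal if no proper subset of it is a Markov basis of $C$. The universal Markov basis $\mathcal{M}(C)$ is the union of all minimal Markov bases of $C$. For $r\ge1$ and matrices $A$ ($d\times n$, columns $a_1,\ldots,a_n$) and $B$ ($p\times n$, columns $b_1,\ldots,b_n$), $\Lambda(A,B,r)$ is the $(rd+p)\times rn$ matrix with columns $(a_i\otimes e_j)\oplus b_i$, $1\le i\le n$, $1\le j\le r$, where $e_j$ is the $j$-th standard basis vector of $\mathbb{Z}^r$. Equivalently, writing vectors of $\mathbb{Z}^{rn}$ as $r\times n$ matrices with rows $u^1,\ldots,u^r$, such a matrix lies in $\ker_{\mathbb{Z}}(\Lambda(A,B,r))$ iff $Au^j=0$ for each $j$ and $B(u^1+\cdots+u^r)=0$. The type of a vector in $\mathbb{Z}^{rn}$, represented as an $r\times n$ matrix, is its number of nonzero rows. The Markov complexity $m(A,B)$ is the largest type of any element of the universal Markov basis $\mathcal{M}(\Lambda(A,B,r))$ as $r$ ranges over all positive integers. The maximum over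 an empty set is taken to be $0$. *)

theory Defs
  imports "Jordan_Normal_Form.Matrix_Kernel" "HOL-Library.Extended_Nat"
begin

definition conformal_decomposition :: "int mat \<Rightarrow> int vec \<Rightarrow> int vec \<Rightarrow> int vec \<Rightarrow> bool" where
  "conformal_decomposition C u v v' \<longleftrightarrow>
     {u, v, v'} \<subseteq> mat_kernel C - {0\<^sub>v (dim_col C)} \<and> u = v + v' \<and>
     (\<forall>i < dim_col C.
        (u $ i \<ge> 0 \<longrightarrow> 0 \<le> v $ i \<and> v $ i \<le> u $ i \<and> 0 \<le> v' $ i \<and> v' $ i \<le> u $ i) \<and>
        (u $ i \<le> 0 \<longrightarrow> u $ i \<le> v $ i \<and> v $ i \<le> 0 \<and> u $ i \<le> v' $ i \<and> v' $ i \<le> 0))"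

definition graver_basis :: "int mat \<Rightarrow> int vec set" where
  "graver_basis C =
     {u \<in> mat_kernel C - {0\<^sub>v (dim_col C)}. \<nexists>v v'. conformal_decomposition C u v v'}"

definition semi_conformal_decomposition :: "int mat \<Rightarrow> int vec \<Rightarrow> int vec \<Rightarrow> int vec \<Rightarrow> bool" where
  "semi_conformal_decomposition A u v v' \<longleftrightarrow>
     {u, v, v'} \<subseteq> mat_kernel A - {0\<^sub>v (dim_col A)} \<and> u = v + v' \<and>
     (\<forall>i < dim_col A.
        (v $ i > 0 \<longrightarrow> v $ i \<le> u $ i) \<and> (v' $ i < 0 \<longrightarrow> u $ i \<le> v' $ i))"

definition semi_conformal_indec :: "int mat \<Rightarrow> int vec set" where
  "semi_conformal_indec A =
     {u \<in> mat_kernel A - {0\<^sub>v (dim_col A)}. \<nexists>v v'. semi_conformal_decomposition A u v v'}"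

text \<open>Moves are used exactly as they occur in \<open>M\<close>: a move and its negative count as two
  different elements. The empty list of moves is allowed, for the case \<open>t = u\<close>.
  The order on vectors is componentwise.\<close>

definition markov_basis :: "int mat \<Rightarrow> int vec set \<Rightarrow> bool" where
  "markov_basis C M \<longleftrightarrow> finite M \<and> M \<subseteq> mat_kernel C \<and>
     (\<forall>t \<in> carrier_vec (dim_col C). \<forall>u \<in> carrier_vec (dim_col C).
        0\<^sub>v (dim_col C) \<le> t \<longrightarrow> 0\<^sub>v (dim_col C) \<le> u \<longrightarrow> C *\<^sub>v t = C *\<^sub>v u \<longrightarrow>
        (\<exists>vs. set vs \<subseteq> M \<and>
              (\<forall>q. 1 \<le> q \<and> q \<le> length vs \<longrightarrow> 0\<^sub>v (dim_col C) \<le> foldl (+) t (take q vs)) \<and>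
              foldl (+) t vs = u))"

definition minimal_markov_basis :: "int mat \<Rightarrow> int vec set \<Rightarrow> bool" where
  "minimal_markov_basis C M \<longleftrightarrow> markov_basis C M \<and> (\<forall>M'. M' \<subset> M \<longrightarrow> \<not> markov_basis C M')"

definition universal_markov_basis :: "int mat \<Rightarrow> int vec set" where
  "universal_markov_basis C = \<Union> {M. minimal_markov_basis C M}"

definition kron_vec :: "'a :: times vec \<Rightarrow> 'a vec \<Rightarrow> 'a vec" where
  "kron_vec u v = vec (dim_vec u * dim_vec v) (\<lambda>k. u $ (k div dim_vec v) * v $ (k mod dim_vec v))"

text \<open>The columns are listed with the index \<open>i < n\<close> of the column of \<open>A\<close> varying fastest: column
  \<open>j * n + i\<close> is \<open>(a\<^sub>i \<otimes> e\<^sub>j) \<oplus> b\<^sub>i\<close> (indices start at 0). With this order, a vector of length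
  \<open>r * n\<close> is the concatenation of the rows of the \<open>r \<times> n\<close> matrix that it represents.\<close>

definition lambda_mat :: "int mat \<Rightarrow> int mat \<Rightarrow> nat \<Rightarrow> int mat" where
  "lambda_mat A B r =
     (let n = dim_col A in
      mat_of_cols (r * dim_row A + dim_row B)
        (map (\<lambda>c. kron_vec (col A (c mod n)) (unit_vec r (c div n)) @\<^sub>v col B (c mod n)) [0..<r * n]))"

definition as_rows :: "nat \<Rightarrow> nat \<Rightarrow> int vec \<Rightarrow> int mat" where
  "as_rows r n x = mat r n (\<lambda>(j, i). x $ (j * n + i))"

definition row_type :: "nat \<Rightarrow> nat \<Rightarrow> int vec \<Rightarrow> nat" where
  "row_type r n x = card {j. j < r \<and> row (as_rows r n x) j \<noteq> 0\<^sub>v n}"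

text \<open>The supremum is taken in \<open>enat\<close>, where \<open>Sup {} = 0\<close>. It is the largest type whenever the types
  are bounded.\<close>

definition markov_complexity :: "int mat \<Rightarrow> int mat \<Rightarrow> enat" where
  "markov_complexity A B =
     Sup {enat (row_type r (dim_col A) x) | r x.
            1 \<le> r \<and> x \<in> universal_markov_basis (lambda_mat A B r)}"

definition l1_norm :: "int vec \<Rightarrow> nat" where
  "l1_norm w = nat (\<Sum>i < dim_vec w. \<bar>w $ i\<bar>)"


lemma mat_kernel_lambda_mat:
  assumes A: "A \<in> carrier_mat d n" and B: "B \<in> carrier_mat p n"
  shows "x \<in> mat_kernel (lambda_mat A B r) \<longleftrightarrow>
    x \<in> carrier_vec (r * n) \<and>
    (\<forall>j < r. A *\<^sub>v row (as_rows r n x) j = 0\<^sub>v d) \<and>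
    B *\<^sub>v vec n (\<lambda>i. \<Sum>j<r. as_rows r n x $$ (j, i)) = 0\<^sub>v p"
proof (cases "x \<in> carrier_vec (r * n)")
  case False
  then show ?thesis using A by (auto simp: mat_kernel_def lambda_mat_def Let_def)
next
  case x: True
  have dA: "dim_row A = d" "dim_col A = n" "dim_row B = p" "dim_col B = n" using A B by auto
  have split: "(\<Sum>c = 0..<r * n. f c) = (\<Sum>j<r. \<Sum>i<n. f (j * n + i))" for f :: "nat \<Rightarrow> int"
  proof -
    have "(\<Sum>c = 0..<r * n. f c) = (\<Sum>c<r * n. f c)" by (simp add: atLeast0LessThan)
    also have "\<dots> = (\<Sum>j<r. \<Sum>c = j * n..<j * n + n. f c)" by (rule sum.nat_group[symmetric])
    also have "\<dots> = (\<Sum>j<r. \<Sum>i<n. f (j * n + i))"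
    proof (rule sum.cong[OF refl])
      fix j
      show "(\<Sum>c = j * n..<j * n + n. f c) = (\<Sum>i<n. f (j * n + i))"
        by (rule sum.reindex_bij_witness[of _ "\<lambda>i. j * n + i" "\<lambda>c. c - j * n"]) auto
    qed
    finally show ?thesis .
  qed
  let ?L = "lambda_mat A B r"
  have dL: "dim_row ?L = r * d + p" "dim_col ?L = r * n"
    by (auto simp: lambda_mat_def Let_def dA)
  have ent: "?L $$ (k, j * n + i) =
      (if k < r * d then (if k mod r = j then A $$ (k div r, i) else 0) else B $$ (k - r * d, i))"
    if "k < r * d + p" "j < r" "i < n" for k j i
  proof -
    have lt: "j * n + i < r * n"
    proof -
      have "j * n + i < Suc j * n" using that by simp
      also have "\<dots> \<le> r * n" using that by (intro mult_right_mono) auto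
      finally show ?thesis .
    qed
    have "k div r < d" if "k < r * d"
      using that by (simp add: less_mult_imp_div_less mult.commute)
    moreover have "k mod r < r" using that by simp
    ultimately show ?thesis using that lt
      by (auto simp: lambda_mat_def Let_def dA mat_of_cols_index kron_vec_def unit_vec_def
          append_vec_def mult.commute)
  qed
  have mv: "(?L *\<^sub>v x) $ k = (\<Sum>j<r. \<Sum>i<n. ?L $$ (k, j * n + i) * x $ (j * n + i))"
    if "k < r * d + p" for k
  proof -
    have "(?L *\<^sub>v x) $ k = (\<Sum>c = 0..<r * n. ?L $$ (k, c) * x $ c)"
      using that x dL by (auto simp: scalar_prod_def)
    then show ?thesis by (simp add: split)
  qed
  have top: "(?L *\<^sub>v x) $ (l * r + j) = (A *\<^sub>v row (as_rows r n x) j) $ l" if "l < d" "j < r" for l j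
  proof -
    have lt: "l * r + j < r * d"
    proof -
      have "l * r + j < Suc l * r" using that by simp
      also have "\<dots> \<le> d * r" using that by (intro mult_right_mono) auto
      finally show ?thesis by (simp add: mult.commute)
    qed
    have "(?L *\<^sub>v x) $ (l * r + j) =
        (\<Sum>j'<r. \<Sum>i<n. if j = j' then A $$ (l, i) * x $ (j' * n + i) else 0)"
      using lt that by (subst mv, simp, intro sum.cong refl) (auto simp: ent)
    also have "\<dots> = (\<Sum>j'<r. if j = j' then \<Sum>i<n. A $$ (l, i) * x $ (j' * n + i) else 0)"
      by (intro sum.cong refl) auto
    also have "\<dots> = (\<Sum>i<n. A $$ (l, i) * x $ (j * n + i))"
      using that by simp
    also have "\<dots> = (A *\<^sub>v row (as_rows r n x) j) $ l"
      using that dA by (auto simp: scalar_prod_def as_rows_def atLeast0LessThan intro!: sum.cong)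
    finally show ?thesis .
  qed
  have bot: "(?L *\<^sub>v x) $ (r * d + l) = (B *\<^sub>v vec n (\<lambda>i. \<Sum>j<r. as_rows r n x $$ (j, i))) $ l"
    if "l < p" for l
  proof -
    have "(?L *\<^sub>v x) $ (r * d + l) = (\<Sum>j<r. \<Sum>i<n. B $$ (l, i) * x $ (j * n + i))"
      using that by (subst mv, simp, intro sum.cong refl) (auto simp: ent)
    also have "\<dots> = (\<Sum>i<n. \<Sum>j<r. B $$ (l, i) * x $ (j * n + i))" by (rule sum.swap)
    also have "\<dots> = (B *\<^sub>v vec n (\<lambda>i. \<Sum>j<r. as_rows r n x $$ (j, i))) $ l"
      using that dA
      by (auto simp: scalar_prod_def as_rows_def atLeast0LessThan sum_distrib_left intro!: sum.cong)
    finally show ?thesis .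
  qed
  have "?L *\<^sub>v x = 0\<^sub>v (r * d + p) \<longleftrightarrow> (\<forall>k < r * d + p. (?L *\<^sub>v x) $ k = 0)"
    by (auto simp: dL vec_eq_iff)
  also have "\<dots> \<longleftrightarrow> (\<forall>k < r * d. (?L *\<^sub>v x) $ k = 0) \<and> (\<forall>l < p. (?L *\<^sub>v x) $ (r * d + l) = 0)"
  proof safe
    fix k assume a: "\<forall>k < r * d. (?L *\<^sub>v x) $ k = 0" "\<forall>l < p. (?L *\<^sub>v x) $ (r * d + l) = 0"
      and k: "k < r * d + p"
    show "(?L *\<^sub>v x) $ k = 0"
    proof (cases "k < r * d")
      case True
      then show ?thesis using a(1) by blast
    next
      case False
      then have "k - r * d < p" "r * d + (k - r * d) = k" using k by auto
      then show ?thesis using a(2) by metis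
    qed
  qed simp_all
  also have "(\<forall>k < r * d. (?L *\<^sub>v x) $ k = 0) \<longleftrightarrow>
      (\<forall>j < r. \<forall>l < d. (?L *\<^sub>v x) $ (l * r + j) = 0)"
  proof safe
    fix j l assume a: "\<forall>k < r * d. (?L *\<^sub>v x) $ k = 0" "j < r" "l < d"
    have "l * r + j < Suc l * r" using a by simp
    also have "\<dots> \<le> d * r" using a by (intro mult_right_mono) auto
    finally show "(?L *\<^sub>v x) $ (l * r + j) = 0" using a by (simp add: mult.commute)
  next
    fix k assume a: "\<forall>j < r. \<forall>l < d. (?L *\<^sub>v x) $ (l * r + j) = 0" "k < r * d"
    have "r \<noteq> 0" using a(2) by (intro notI) simp
    then have "k div r < d" "k mod r < r"
      using a(2) by (simp_all add: less_mult_imp_div_less mult.commute)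
    then have "(?L *\<^sub>v x) $ (k div r * r + k mod r) = 0" using a(1) by blast
    then show "(?L *\<^sub>v x) $ k = 0" by simp
  qed
  finally show ?thesis
    using x dA by (auto simp: mat_kernel_def dL vec_eq_iff top bot simp del: index_mult_mat_vec)
qed

lemma dickson_subseq:
  fixes f :: "nat \<Rightarrow> nat \<Rightarrow> nat"
  shows "\<exists>g :: nat \<Rightarrow> nat. strict_mono g \<and> (\<forall>c<k. mono (\<lambda>i. f (g i) c))"
proof (induction k)
  case 0
  show ?case by (rule exI[of _ id]) (simp add: strict_mono_def)
next
  case (Suc k)
  then obtain g :: "nat \<Rightarrow> nat" where g: "strict_mono g" "\<forall>c<k. mono (\<lambda>i. f (g i) c)" by blast
  obtain h :: "nat \<Rightarrow> nat" where h: "strict_mono h" "monoseq (\<lambda>i. f (g (h i)) k)"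
    using seq_monosub[of "\<lambda>i. f (g i) k"] by auto
  have "\<exists>m. mono (\<lambda>i. f (g (h (m + i))) k)"
  proof (cases "incseq (\<lambda>i. f (g (h i)) k)")
    case True
    then show ?thesis by (intro exI[of _ 0]) simp
  next
    case False
    then have dec: "decseq (\<lambda>i. f (g (h i)) k)" using h(2) by (simp add: monoseq_iff)
    define m where "m = (ARG_MIN (\<lambda>i. f (g (h i)) k) i. True)"
    have le: "f (g (h m)) k \<le> f (g (h i)) k" for i
      unfolding m_def by (rule arg_min_nat_le) simp
    have "f (g (h (m + i))) k = f (g (h m)) k" for i
      using le[of "m + i"] decseqD[OF dec, of m "m + i"] by simp
    then show ?thesis by (intro exI[of _ m]) (simp add: mono_def)
  qed
  then obtain m where m: "mono (\<lambda>i. f (g (h (m + i))) k)" by blast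
  have s: "strict_mono (\<lambda>i. h (m + i))" using h(1) by (simp add: strict_mono_def)
  have "mono (\<lambda>i. f (g (h (m + i))) c)" if "c < Suc k" for c
  proof (cases "c = k")
    case False
    then have "mono (\<lambda>i. f (g i) c)" using that g(2) by simp
    then show ?thesis
      using strict_mono_mono[OF s] by (auto simp: mono_def)
  qed (use m in simp)
  moreover have "strict_mono (\<lambda>i. g (h (m + i)))"
    using g(1) s by (simp add: strict_mono_def)
  ultimately show ?case by (intro exI[of _ "\<lambda>i. g (h (m + i))"]) blast
qed

lemma finite_graver_basis: "finite (graver_basis C)"
proof (rule ccontr)
  assume "infinite (graver_basis C)"
  then obtain F :: "nat \<Rightarrow> int vec" where F: "inj F" "range F \<subseteq> graver_basis C"
    using infinite_countable_subset by blast
  let ?N = "dim_col C"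
  define f where "f i c = (if c < ?N then nat (F i $ c) else nat (- (F i $ (c - ?N))))" for i c
  obtain g :: "nat \<Rightarrow> nat" where g: "strict_mono g" "\<forall>c<2 * ?N. mono (\<lambda>i. f (g i) c)"
    using dickson_subseq[of "2 * ?N" f] by blast
  define v where "v = F (g 0)"
  define u where "u = F (g 1)"
  have ne: "v \<noteq> u" using F(1) g(1) unfolding u_def v_def
    by (metis injD strict_mono_eq zero_neq_one)
  have uv: "u \<in> graver_basis C" "v \<in> graver_basis C" using F(2) by (auto simp: u_def v_def)
  then have ker: "u \<in> mat_kernel C" "v \<in> mat_kernel C" "u \<noteq> 0\<^sub>v ?N" "v \<noteq> 0\<^sub>v ?N"
    by (auto simp: graver_basis_def)
  then have car: "u \<in> carrier_vec ?N" "v \<in> carrier_vec ?N"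
    and z: "C *\<^sub>v u = 0\<^sub>v (dim_row C)" "C *\<^sub>v v = 0\<^sub>v (dim_row C)"
    by (auto simp: mat_kernel_def)
  have "C *\<^sub>v (u - v) = C *\<^sub>v u - C *\<^sub>v v"
    by (rule mult_minus_distrib_mat_vec) (use car in auto)
  then have d: "u - v \<in> mat_kernel C" using car z by (auto simp: mat_kernel_def)
  have dn: "u - v \<noteq> 0\<^sub>v ?N"
  proof
    assume a: "u - v = 0\<^sub>v ?N"
    have "v $ i = u $ i" if "i < ?N" for i
      using arg_cong[OF a, of "\<lambda>w. w $ i"] that car by simp
    then show False using ne car by (auto intro!: eq_vecI)
  qed
  have pos: "nat (v $ i) \<le> nat (u $ i)" "nat (- (v $ i)) \<le> nat (- (u $ i))" if "i < ?N" for i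
    using g(2)[rule_format, of i, THEN monoD, of 0 1]
      g(2)[rule_format, of "?N + i", THEN monoD, of 0 1] that
    by (auto simp: f_def u_def v_def)
  have "conformal_decomposition C u v (u - v)"
    unfolding conformal_decomposition_def
  proof (intro conjI allI impI)
    show "{u, v, u - v} \<subseteq> mat_kernel C - {0\<^sub>v ?N}" using ker d dn by auto
    show "u = v + (u - v)" using car by auto
  qed (use pos car in \<open>force+\<close>)
  then show False using uv by (auto simp: graver_basis_def)
qed

lemma finite_semi_conformal_indec: "finite (semi_conformal_indec A)"
proof -
  have "semi_conformal_decomposition A u v v'" if "conformal_decomposition A u v v'" for u v v'
    using that unfolding conformal_decomposition_def semi_conformal_decomposition_def
    by (smt (verit, ccfv_SIG))
  then have "semi_conformal_indec A \<subseteq> graver_basis A"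
    unfolding semi_conformal_indec_def graver_basis_def by blast
  then show ?thesis using finite_graver_basis finite_subset by blast
qed

end

theory Submission
  imports Defs
begin

text \<open>Let \<open>w\<close> be a Graver basis element of \<open>B \<cdot> S(A)\<close> and \<open>r\<close> its 1-norm. The \<open>r \<times> n\<close> matrix having
  \<open>\<bar>w\<^sub>k\<bar>\<close> rows equal to \<open>sgn w\<^sub>k \<cdot> v\<^sub>k\<close> for each \<open>v\<^sub>k \<in> S(A)\<close> lies in the kernel of \<open>\<Lambda>(A, B, r)\<close> and
  has type \<open>r\<close>. In a semi-conformal decomposition of it every row has to go entirely to one of
  the two summands, because \<open>S(A) = - S(A)\<close> and its elements do not decompose; the rows taken by the
  first summand then yield a conformal decomposition of \<open>w\<close>. So the matrix has no semi-conformal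
  decomposition, and vectors without one are indispensable: they belong to every Markov basis.\<close>

section \<open>Kernels and Markov bases\<close>

lemma mat_kernel_minus:
  fixes C :: "'a :: comm_ring_1 mat"
  assumes "u \<in> mat_kernel C" "v \<in> mat_kernel C"
  shows "u - v \<in> mat_kernel C"
  using assms mult_minus_distrib_mat_vec[of C "dim_row C" "dim_col C" u v]
  by (auto simp: mat_kernel_def)

lemma mat_kernel_uminus:
  fixes C :: "'a :: comm_ring_1 mat"
  assumes "u \<in> mat_kernel C"
  shows "- u \<in> mat_kernel C"
  using assms by (auto simp: mat_kernel_def vec_eq_iff)

lemma minus_eq_zero_vec_iff:
  fixes u v :: "'a :: ab_group_add vec"
  assumes "u \<in> carrier_vec N" "v \<in> carrier_vec N"
  shows "u - v = 0\<^sub>v N \<longleftrightarrow> u = v"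
  using assms by (auto simp: vec_eq_iff)

section \<open>The Graver basis as a Markov basis\<close>

lemma int_l1_norm: "int (l1_norm w) = (\<Sum>i<dim_vec w. \<bar>w $ i\<bar>)"
  by (simp add: l1_norm_def sum_nonneg)

text \<open>In every coordinate both summands have the sign of \<open>u\<close>, so no cancellation
  occurs and \<open>\<bar>v $ i\<bar> \<le> \<bar>u $ i\<bar>\<close>; this is strict wherever
  \<open>v'\<close> is nonzero.\<close>

lemma l1_norm_conformal_less:
  assumes "conformal_decomposition C u v v'"
  shows "l1_norm v < l1_norm u"
proof -
  have car: "u \<in> carrier_vec (dim_col C)" "v \<in> carrier_vec (dim_col C)" "v' \<in> carrier_vec (dim_col C)"
    and u: "u = v + v'" and nz: "v' \<noteq> 0\<^sub>v (dim_col C)"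
    and sgn: "\<forall>i < dim_col C.
        (u $ i \<ge> 0 \<longrightarrow> 0 \<le> v $ i \<and> v $ i \<le> u $ i) \<and> (u $ i \<le> 0 \<longrightarrow> u $ i \<le> v $ i \<and> v $ i \<le> 0)"
    using assms by (auto simp: conformal_decomposition_def mat_kernel_def)
  obtain i where i: "i < dim_col C" "v' $ i \<noteq> 0"
    using nz car(3) by (metis carrier_vecD eq_vecI index_zero_vec)
  have "(\<Sum>i<dim_col C. \<bar>v $ i\<bar>) < (\<Sum>i<dim_col C. \<bar>u $ i\<bar>)"
  proof (rule sum_strict_mono_ex1)
    show "\<forall>i\<in>{..<dim_col C}. \<bar>v $ i\<bar> \<le> \<bar>u $ i\<bar>"
      using sgn by (smt (verit) lessThan_iff)
    have "u $ i = v $ i + v' $ i" using i car u by simp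
    then have "\<bar>v $ i\<bar> < \<bar>u $ i\<bar>" using sgn i by (smt (verit))
    then show "\<exists>i\<in>{..<dim_col C}. \<bar>v $ i\<bar> < \<bar>u $ i\<bar>" using i by auto
  qed simp
  then have "int (l1_norm v) < int (l1_norm u)"
    using car unfolding int_l1_norm by simp
  then show ?thesis by simp
qed

text \<open>Descent on the 1-norm: a vector outside the Graver basis has a conformal summand of
  smaller norm, and conformality is transitive.\<close>

lemma conformal_graver_element:
  assumes "z \<in> mat_kernel C" "z \<noteq> 0\<^sub>v (dim_col C)"
  shows "\<exists>g \<in> graver_basis C. \<forall>i < dim_col C.
           (z $ i \<ge> 0 \<longrightarrow> 0 \<le> g $ i \<and> g $ i \<le> z $ i) \<and> (z $ i \<le> 0 \<longrightarrow> z $ i \<le> g $ i \<and> g $ i \<le> 0)"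
  using assms
proof (induction "l1_norm z" arbitrary: z rule: less_induct)
  case less
  show ?case
  proof (cases "z \<in> graver_basis C")
    case True
    then show ?thesis by auto
  next
    case False
    then obtain v v' where d: "conformal_decomposition C z v v'"
      using less.prems by (auto simp: graver_basis_def)
    then have v: "v \<in> mat_kernel C" "v \<noteq> 0\<^sub>v (dim_col C)"
      and s: "\<forall>i < dim_col C. (z $ i \<ge> 0 \<longrightarrow> 0 \<le> v $ i \<and> v $ i \<le> z $ i) \<and>
        (z $ i \<le> 0 \<longrightarrow> z $ i \<le> v $ i \<and> v $ i \<le> 0)"
      by (auto simp: conformal_decomposition_def)
    obtain g where g: "g \<in> graver_basis C" "\<forall>i < dim_col C.
        (v $ i \<ge> 0 \<longrightarrow> 0 \<le> g $ i \<and> g $ i \<le> v $ i) \<and> (v $ i \<le> 0 \<longrightarrow> v $ i \<le> g $ i \<and> g $ i \<le> 0)"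
      using less.hyps[OF l1_norm_conformal_less[OF d] v] by blast
    have "(z $ i \<ge> 0 \<longrightarrow> 0 \<le> g $ i \<and> g $ i \<le> z $ i) \<and> (z $ i \<le> 0 \<longrightarrow> z $ i \<le> g $ i \<and> g $ i \<le> 0)"
      if "i < dim_col C" for i
      using s[rule_format, OF that] g(2)[rule_format, OF that] by linarith
    then show ?thesis using g(1) by blast
  qed
qed

text \<open>Induction on the distance from \<open>t\<close> to \<open>u\<close>. A Graver element
  \<open>g\<close> conformal to \<open>u - t\<close> moves every coordinate of \<open>t\<close>
  towards that of \<open>u\<close> without overshooting, so the walk stays nonnegative and the
  distance drops.\<close>

lemma graver_path:
  fixes t u :: "int vec"
  assumes "t \<in> carrier_vec (dim_col C)" "u \<in> carrier_vec (dim_col C)"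
    and "0\<^sub>v (dim_col C) \<le> t" "0\<^sub>v (dim_col C) \<le> u" "u - t \<in> mat_kernel C"
  shows "\<exists>vs. set vs \<subseteq> graver_basis C \<and>
           (\<forall>q. 1 \<le> q \<and> q \<le> length vs \<longrightarrow> 0\<^sub>v (dim_col C) \<le> foldl (+) t (take q vs)) \<and>
           foldl (+) t vs = u"
  using assms
proof (induction "l1_norm (u - t)" arbitrary: t rule: less_induct)
  case less
  let ?N = "dim_col C"
  show ?case
  proof (cases "u = t")
    case True
    then show ?thesis by (intro exI[of _ "[]"]) auto
  next
    case False
    then have nz: "u - t \<noteq> 0\<^sub>v ?N" using less.prems minus_eq_zero_vec_iff by blast
    obtain g where g: "g \<in> graver_basis C" and s: "\<forall>i < ?N.
        ((u - t) $ i \<ge> 0 \<longrightarrow> 0 \<le> g $ i \<and> g $ i \<le> (u - t) $ i) \<and>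
        ((u - t) $ i \<le> 0 \<longrightarrow> (u - t) $ i \<le> g $ i \<and> g $ i \<le> 0)"
      using conformal_graver_element[OF less.prems(5) nz] by blast
    have gk: "g \<in> mat_kernel C" "g \<noteq> 0\<^sub>v ?N" and gc: "g \<in> carrier_vec ?N"
      using g by (auto simp: graver_basis_def mat_kernel_def)
    have nn: "0 \<le> t $ i" "0 \<le> u $ i" if "i < ?N" for i
      using less.prems that by (auto simp: less_eq_vec_def)
    have tg: "0\<^sub>v ?N \<le> t + g"
      unfolding less_eq_vec_def
    proof (intro conjI allI impI)
      fix i assume "i < dim_vec (t + g)"
      then have i: "i < ?N" using gc by simp
      \<comment> \<open>Since \<open>g $ i\<close> lies between 0 and \<open>u $ i - t $ i\<close>,
        the new coordinate lies between \<open>t $ i\<close> and \<open>u $ i\<close>, both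
        nonnegative.\<close>
      then show "0\<^sub>v ?N $ i \<le> (t + g) $ i"
        using s[rule_format, OF i] nn[OF i] less.prems gc by simp linarith
    qed (use gc in simp)
    have eq: "u - (t + g) = (u - t) - g" using less.prems gc by (auto simp: vec_eq_iff)
    obtain i where i: "i < ?N" "g $ i \<noteq> 0"
      using gk(2) gc by (metis carrier_vecD eq_vecI index_zero_vec)
    have "(\<Sum>i<?N. \<bar>(u - (t + g)) $ i\<bar>) < (\<Sum>i<?N. \<bar>(u - t) $ i\<bar>)"
    proof (rule sum_strict_mono_ex1)
      show "\<forall>i\<in>{..<?N}. \<bar>(u - (t + g)) $ i\<bar> \<le> \<bar>(u - t) $ i\<bar>"
      proof
        fix k assume "k \<in> {..<?N}"
        then show "\<bar>(u - (t + g)) $ k\<bar> \<le> \<bar>(u - t) $ k\<bar>"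
          using s[rule_format, of k] less.prems gc unfolding eq by auto
      qed
      have "\<bar>(u - (t + g)) $ i\<bar> < \<bar>(u - t) $ i\<bar>"
        using s[rule_format, of i] i less.prems gc unfolding eq by auto
      then show "\<exists>i\<in>{..<?N}. \<bar>(u - (t + g)) $ i\<bar> < \<bar>(u - t) $ i\<bar>" using i by auto
    qed simp
    then have "int (l1_norm (u - (t + g))) < int (l1_norm (u - t))"
      using less.prems(1) gc unfolding int_l1_norm by simp
    then have "l1_norm (u - (t + g)) < l1_norm (u - t)" by simp
    moreover have "u - (t + g) \<in> mat_kernel C"
      unfolding eq by (rule mat_kernel_minus[OF less.prems(5) gk(1)])
    ultimately obtain vs where vs: "set vs \<subseteq> graver_basis C"
        "\<forall>q. 1 \<le> q \<and> q \<le> length vs \<longrightarrow> 0\<^sub>v ?N \<le> foldl (+) (t + g) (take q vs)"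
        "foldl (+) (t + g) vs = u"
      using less.hyps[of "t + g"] less.prems gc tg by (auto simp del: less_eq_vec_def)
    have "0\<^sub>v ?N \<le> foldl (+) t (take q (g # vs))" if q: "1 \<le> q" "q \<le> length (g # vs)" for q
    \<comment> \<open>The first prefix reaches \<open>t + g\<close>; a longer one is a prefix of the
      remaining walk, with its length shifted by one.\<close>
    proof (cases "q = 1")
      case False
      then obtain q' where "q = Suc q'" "1 \<le> q'" "q' \<le> length vs" using q by (cases q) auto
      then show ?thesis using vs(2) by simp
    qed (use tg in simp)
    then show ?thesis using vs g by (intro exI[of _ "g # vs"]) auto
  qed
qed

lemma markov_basis_graver_basis: "markov_basis C (graver_basis C)"
  unfolding markov_basis_def
proof (intro conjI ballI impI finite_graver_basis)
  show "graver_basis C \<subseteq> mat_kernel C" by (auto simp: graver_basis_def)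
  fix t u :: "int vec"
  assume *: "t \<in> carrier_vec (dim_col C)" "u \<in> carrier_vec (dim_col C)"
    "0\<^sub>v (dim_col C) \<le> t" "0\<^sub>v (dim_col C) \<le> u" "C *\<^sub>v t = C *\<^sub>v u"
  have "C *\<^sub>v (u - t) = C *\<^sub>v u - C *\<^sub>v t"
    by (rule mult_minus_distrib_mat_vec) (use * in auto)
  then have "u - t \<in> mat_kernel C" using * by (auto simp: mat_kernel_def)
  then show "\<exists>vs. set vs \<subseteq> graver_basis C \<and>
      (\<forall>q. 1 \<le> q \<and> q \<le> length vs \<longrightarrow> 0\<^sub>v (dim_col C) \<le> foldl (+) t (take q vs)) \<and>
      foldl (+) t vs = u"
    by (rule graver_path[OF *(1-4)])
qed

section \<open>Minimal Markov bases and indispensable moves\<close>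

text \<open>The finite Graver basis is a Markov basis, and shrinking it as long as possible ends in
  a minimal one. Membership in every Markov basis yields membership in the universal one only
  because some minimal basis exists.\<close>

lemma minimal_markov_basis_exists: "\<exists>M. minimal_markov_basis C M"
proof -
  have "\<exists>M' \<subseteq> M. minimal_markov_basis C M'" if "finite M" "markov_basis C M" for M
    using that
  proof (induction M rule: finite_psubset_induct)
    case (psubset M)
    then show ?case
      unfolding minimal_markov_basis_def by (metis psubset_imp_subset subset_refl subset_trans)
  qed
  then show ?thesis using finite_graver_basis markov_basis_graver_basis by blast
qed

text \<open>Walking from the negative to the positive part of \<open>x\<close>, a nonzero first move \<open>v\<close> gives the
  semi-conformal decomposition \<open>x = (x - v) + v\<close>, unless \<open>v = x\<close>.\<close>

lemma indispensable_path:
  fixes x t :: "int vec"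
  assumes x: "x \<in> semi_conformal_indec C" and t: "t = vec (dim_col C) (\<lambda>i. max 0 (- (x $ i)))"
    and "set vs \<subseteq> mat_kernel C"
    and "\<forall>q. 1 \<le> q \<and> q \<le> length vs \<longrightarrow> 0\<^sub>v (dim_col C) \<le> foldl (+) t (take q vs)"
    and "foldl (+) t vs = vec (dim_col C) (\<lambda>i. max 0 (x $ i))"
  shows "x \<in> set vs"
  using assms(3-)
proof (induction vs)
  let ?N = "dim_col C"
  have xk: "x \<in> mat_kernel C" "x \<noteq> 0\<^sub>v ?N" and xc: "x \<in> carrier_vec ?N"
    using x by (auto simp: semi_conformal_indec_def mat_kernel_def)
  case Nil
  \<comment> \<open>For an empty walk the negative and positive parts of \<open>x\<close> coincide;
    having disjoint supports, they both vanish.\<close>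
  then have "max 0 (- (x $ i)) = max 0 (x $ i)" if "i < ?N" for i
    using that t by (auto simp: vec_eq_iff)
  then have "x $ i = 0" if "i < ?N" for i
    using that by (smt (verit))
  then have "x = 0\<^sub>v ?N" using xc by (auto simp: vec_eq_iff)
  then show ?case using xk by simp
next
  let ?N = "dim_col C"
  have xk: "x \<in> mat_kernel C" "x \<noteq> 0\<^sub>v ?N" and xc: "x \<in> carrier_vec ?N"
    using x by (auto simp: semi_conformal_indec_def mat_kernel_def)
  case (Cons v vs)
  have vk: "v \<in> mat_kernel C" and vc: "v \<in> carrier_vec ?N"
    using Cons.prems by (auto simp: mat_kernel_def)
  have "0\<^sub>v ?N \<le> t + v" using Cons.prems(2)[rule_format, of 1] by simp
  then have ge: "0 \<le> max 0 (- (x $ i)) + v $ i" if "i < ?N" for i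
    using that vc t by (auto simp: less_eq_vec_def)
  consider "v = x" | "v = 0\<^sub>v ?N" | "v \<noteq> x" "v \<noteq> 0\<^sub>v ?N" by blast
  then show ?case
  proof cases
    \<comment> \<open>A Markov basis may contain the zero vector. Such a move leaves
      \<open>t\<close> unchanged, so the induction hypothesis applies to the rest of the
      walk.\<close>
    case 2
    then have tv: "t + v = t" using t by auto
    have "0\<^sub>v ?N \<le> foldl (+) t (take q vs)" if "1 \<le> q \<and> q \<le> length vs" for q
      using Cons.prems(2)[rule_format, of "Suc q"] that tv by simp
    then show ?thesis using Cons.IH Cons.prems tv by simp
  next
    case 3
    have "semi_conformal_decomposition C x (x - v) v"
      unfolding semi_conformal_decomposition_def
    proof (intro conjI allI impI)
      show "{x, x - v, v} \<subseteq> mat_kernel C - {0\<^sub>v ?N}"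
        using 3 xk vk mat_kernel_minus[OF xk(1) vk] minus_eq_zero_vec_iff[OF xc vc] by auto
      show "x = x - v + v" using xc vc by auto
      fix i assume i: "i < ?N"
      \<comment> \<open>By \<open>ge\<close>, \<open>v $ i\<close> is at least
        \<open>min 0 (x $ i)\<close>. Hence \<open>v $ i < x $ i\<close> forces
        \<open>v $ i \<ge> 0\<close>, and \<open>v $ i < 0\<close> forces
        \<open>x $ i \<le> v $ i\<close>.\<close>
      show "(x - v) $ i \<le> x $ i" if "0 < (x - v) $ i"
        using that ge[OF i] i xc vc by auto
      show "x $ i \<le> v $ i" if "v $ i < 0"
        using that ge[OF i] by auto
    qed
    then show ?thesis using x by (auto simp: semi_conformal_indec_def)
  qed simp
qed

text \<open>The negative and positive parts of \<open>x\<close> are nonnegative and differ by the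
  kernel vector \<open>x\<close>. Every Markov basis therefore joins them by a walk, and such a walk
  has to use \<open>x\<close> itself.\<close>

lemma semi_conformal_indec_subset_markov_basis:
  assumes M: "markov_basis C M"
  shows "semi_conformal_indec C \<subseteq> M"
proof
  fix x assume x: "x \<in> semi_conformal_indec C"
  let ?N = "dim_col C"
  define t where "t = vec ?N (\<lambda>i. max 0 (- (x $ i)))"
  define u where "u = vec ?N (\<lambda>i. max 0 (x $ i))"
  have xk: "C *\<^sub>v x = 0\<^sub>v (dim_row C)" and xc: "x \<in> carrier_vec ?N"
    using x by (auto simp: semi_conformal_indec_def mat_kernel_def)
  have car: "t \<in> carrier_vec ?N" "u \<in> carrier_vec ?N" by (auto simp: t_def u_def)
  have nn: "0\<^sub>v ?N \<le> t" "0\<^sub>v ?N \<le> u" by (auto simp: t_def u_def less_eq_vec_def)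
  have "u = t + x" using xc by (auto simp: t_def u_def vec_eq_iff)
  then have "C *\<^sub>v t = C *\<^sub>v u"
    using mult_add_distrib_mat_vec[of C "dim_row C" ?N t x] xk xc car by auto
  then obtain vs where vs: "set vs \<subseteq> M"
      "\<forall>q. 1 \<le> q \<and> q \<le> length vs \<longrightarrow> 0\<^sub>v ?N \<le> foldl (+) t (take q vs)" "foldl (+) t vs = u"
    using M car nn unfolding markov_basis_def by blast
  moreover have "M \<subseteq> mat_kernel C" using M by (simp add: markov_basis_def)
  ultimately have "x \<in> set vs"
    using indispensable_path[OF x t_def, of vs] by (auto simp: u_def)
  then show "x \<in> M" using vs by blast
qed

lemma semi_conformal_indec_subset_universal: "semi_conformal_indec C \<subseteq> universal_markov_basis C"
  using minimal_markov_basis_exists[of C] semi_conformal_indec_subset_markov_basis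
  unfolding universal_markov_basis_def minimal_markov_basis_def by blast

text \<open>Negation interchanges the two sign conditions of a semi-conformal decomposition, so the
  summands have to trade places: \<open>- u = v + v'\<close> becomes
  \<open>u = (- v') + (- v)\<close>.\<close>

lemma semi_conformal_indec_uminus:
  assumes "u \<in> semi_conformal_indec A"
  shows "- u \<in> semi_conformal_indec A"
proof -
  let ?N = "dim_col A"
  have neg: "w \<in> mat_kernel A - {0\<^sub>v ?N} \<Longrightarrow> - w \<in> mat_kernel A - {0\<^sub>v ?N}" for w
    using mat_kernel_uminus[of w A] by (auto simp: mat_kernel_def vec_eq_iff)
  have "semi_conformal_decomposition A u (- v') (- v)"
    if d: "semi_conformal_decomposition A (- u) v v'" for v v'
  proof -
    have k: "v \<in> mat_kernel A - {0\<^sub>v ?N}" "v' \<in> mat_kernel A - {0\<^sub>v ?N}" and e: "- u = v + v'"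
      and s: "\<forall>i < ?N. (v $ i > 0 \<longrightarrow> v $ i \<le> (- u) $ i) \<and> (v' $ i < 0 \<longrightarrow> (- u) $ i \<le> v' $ i)"
      using d by (auto simp: semi_conformal_decomposition_def)
    have car: "u \<in> carrier_vec ?N" "v \<in> carrier_vec ?N" "v' \<in> carrier_vec ?N"
      using assms k by (auto simp: semi_conformal_indec_def mat_kernel_def)
    have ev: "- (u $ i) = v $ i + v' $ i" if "i < ?N" for i
      using arg_cong[OF e, of "\<lambda>w. w $ i"] that car by simp
    show ?thesis
      unfolding semi_conformal_decomposition_def
    proof (intro conjI)
      show "{u, - v', - v} \<subseteq> mat_kernel A - {0\<^sub>v ?N}"
        using assms neg[OF k(1)] neg[OF k(2)] by (auto simp: semi_conformal_indec_def)
      have "u $ i = - (v' $ i) + - (v $ i)" if "i < ?N" for i using ev[OF that] by simp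
      then show "u = - v' + - v" using car by (intro eq_vecI) auto
      show "\<forall>i<?N. (0 < (- v') $ i \<longrightarrow> (- v') $ i \<le> u $ i) \<and> ((- v) $ i < 0 \<longrightarrow> u $ i \<le> (- v) $ i)"
        using s car by fastforce
    qed
  qed
  then show ?thesis using assms neg[of u] by (auto simp: semi_conformal_indec_def)
qed

section \<open>Matrices with prescribed rows\<close>

lemma row_as_rows_vec:
  assumes "j < r" "\<And>j. j < r \<Longrightarrow> y j \<in> carrier_vec n"
  shows "row (as_rows r n (vec (r * n) (\<lambda>c. y (c div n) $ (c mod n)))) j = y j"
proof (rule eq_vecI)
  fix i assume "i < dim_vec (y j)"
  then have i: "i < n" using assms(2)[OF assms(1)] by simp
  have "j * n + i < Suc j * n" using i by simp
  also have "\<dots> \<le> r * n" using assms(1) by (intro mult_right_mono) auto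
  finally show "row (as_rows r n (vec (r * n) (\<lambda>c. y (c div n) $ (c mod n)))) j $ i = y j $ i"
    using i assms(1) by (simp add: as_rows_def)
qed (use assms(2)[OF assms(1)] in \<open>simp add: as_rows_def\<close>)

lemma row_as_rows_add:
  assumes "j < r" "v \<in> carrier_vec (r * n)" "v' \<in> carrier_vec (r * n)"
  shows "row (as_rows r n (v + v')) j = row (as_rows r n v) j + row (as_rows r n v') j"
proof (rule eq_vecI)
  fix i assume "i < dim_vec (row (as_rows r n v) j + row (as_rows r n v') j)"
  then have i: "i < n" by (simp add: as_rows_def)
  have "j * n + i < Suc j * n" using i by simp
  also have "\<dots> \<le> r * n" using assms(1) by (intro mult_right_mono) auto
  finally show "row (as_rows r n (v + v')) j $ i =
      (row (as_rows r n v) j + row (as_rows r n v') j) $ i"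
    using i assms by (simp add: as_rows_def)
qed (simp add: as_rows_def)

lemma nonzero_row_exists:
  assumes "v \<in> carrier_vec (r * n)" "v \<noteq> 0\<^sub>v (r * n)"
  shows "\<exists>j<r. row (as_rows r n v) j \<noteq> 0\<^sub>v n"
proof -
  obtain c where c: "c < r * n" "v $ c \<noteq> 0"
    using assms by (metis carrier_vecD eq_vecI index_zero_vec)
  have n: "0 < n" using c(1) by (cases n) auto
  have j: "c div n < r" using c(1) by (simp add: less_mult_imp_div_less)
  have "row (as_rows r n v) (c div n) $ (c mod n) = v $ c"
    using j n by (simp add: as_rows_def)
  then have "row (as_rows r n v) (c div n) \<noteq> 0\<^sub>v n" using c(2) n by auto
  then show ?thesis using j by blast
qed

section \<open>Repeating rows and counting the repetitions\<close>

text \<open>Number the pairs \<open>(k, i)\<close> with \<open>i < m k\<close> and read off first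
  components. This tells which vector is placed in row \<open>j\<close> when the \<open>k\<close>-th
  vector is to fill \<open>m k\<close> rows.\<close>

lemma exists_map_with_multiplicities:
  fixes m :: "'a \<Rightarrow> nat"
  assumes "finite K"
  shows "\<exists>\<kappa>. (\<forall>j < sum m K. \<kappa> j \<in> K) \<and> (\<forall>k\<in>K. card {j. j < sum m K \<and> \<kappa> j = k} = m k)"
proof -
  let ?S = "Sigma K (\<lambda>k. {..<m k})"
  have "card ?S = sum m K" using assms by simp
  moreover have "finite ?S" using assms by simp
  ultimately obtain h where h: "bij_betw h {0..<sum m K} ?S"
    using ex_bij_betw_nat_finite by metis
  have "card {j. j < sum m K \<and> fst (h j) = k} = m k" if k: "k \<in> K" for k
  proof -
    have "h ` {j. j < sum m K \<and> fst (h j) = k} = {k} \<times> {..<m k}"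
    proof (intro equalityI subsetI)
      fix s assume "s \<in> {k} \<times> {..<m k}"
      then have "s \<in> h ` {0..<sum m K}" "fst s = k"
        using k bij_betw_imp_surj_on[OF h] by auto
      then show "s \<in> h ` {j. j < sum m K \<and> fst (h j) = k}" by auto
    next
      fix s assume "s \<in> h ` {j. j < sum m K \<and> fst (h j) = k}"
      then have "s \<in> ?S" "fst s = k" using bij_betwE[OF h] by auto
      then show "s \<in> {k} \<times> {..<m k}" by auto
    qed
    moreover have "inj_on h {j. j < sum m K \<and> fst (h j) = k}"
      using bij_betw_imp_inj_on[OF h] by (rule inj_on_subset) auto
    ultimately have "card {j. j < sum m K \<and> fst (h j) = k} = card ({k} \<times> {..<m k})"
      using card_image[of h "{j. j < sum m K \<and> fst (h j) = k}"] by simp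
    then show ?thesis by simp
  qed
  moreover have "fst (h j) \<in> K" if "j < sum m K" for j
  proof -
    have "h j \<in> ?S" using bij_betwE[OF h] that by simp
    then show ?thesis by (auto simp: mem_Sigma_iff)
  qed
  ultimately show ?thesis by (intro exI[of _ "\<lambda>j. fst (h j)"]) auto
qed

text \<open>Translates between selections \<open>J\<close> of rows and vectors indexed by the
  columns of \<open>B \<cdot> S(A)\<close>: collecting equal rows turns the sum of the selected
  signed rows into a combination whose coefficients are signed counts.\<close>

lemma row_combination_mult_mat_vec:
  fixes B :: "int mat" and s :: "nat \<Rightarrow> int"
  assumes B: "B \<in> carrier_mat p n" and vs: "set vs \<subseteq> carrier_vec n"
    and J: "finite J" "\<And>j. j \<in> J \<Longrightarrow> \<kappa> j < length vs"
  shows "mat_of_cols p (map ((*\<^sub>v) B) vs) *\<^sub>v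
           vec (length vs) (\<lambda>k. s k * int (card {j \<in> J. \<kappa> j = k})) =
         B *\<^sub>v vec n (\<lambda>i. \<Sum>j\<in>J. s (\<kappa> j) * vs ! \<kappa> j $ i)"
proof (rule eq_vecI)
  fix l assume "l < dim_vec (B *\<^sub>v vec n (\<lambda>i. \<Sum>j\<in>J. s (\<kappa> j) * vs ! \<kappa> j $ i))"
  then have l: "l < p" using B by simp
  let ?b = "\<lambda>k. \<Sum>i<n. B $$ (l, i) * vs ! k $ i"
  have b: "(B *\<^sub>v vs ! k) $ l = ?b k" if "k < length vs" for k
  proof -
    have "vs ! k \<in> carrier_vec n" using vs that nth_mem by blast
    then show ?thesis using l B by (auto simp: scalar_prod_def atLeast0LessThan intro!: sum.cong)
  qed
  have col: "mat_of_cols p (map ((*\<^sub>v) B) vs) $$ (l, k) = ?b k" if "k < length vs" for k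
    using l that b[OF that] by (simp add: mat_of_cols_index del: index_mult_mat_vec)
  have "(mat_of_cols p (map ((*\<^sub>v) B) vs) *\<^sub>v
           vec (length vs) (\<lambda>k. s k * int (card {j \<in> J. \<kappa> j = k}))) $ l =
        (\<Sum>k<length vs. mat_of_cols p (map ((*\<^sub>v) B) vs) $$ (l, k) * (s k * int (card {j \<in> J. \<kappa> j = k})))"
    using l by (simp add: scalar_prod_def atLeast0LessThan)
  also have "\<dots> = (\<Sum>k<length vs. ?b k * (s k * int (card {j \<in> J. \<kappa> j = k})))"
    by (intro sum.cong refl) (simp only: col lessThan_iff)
  \<comment> \<open>On the class of all \<open>j\<close> with \<open>\<kappa> j = k\<close> the
    summand is constant, so the factor \<open>card\<close> becomes a sum over the class; the classes
    then merge into \<open>J\<close>.\<close>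
  also have "\<dots> = (\<Sum>k<length vs. \<Sum>j\<in>{j \<in> J. \<kappa> j = k}. ?b (\<kappa> j) * s (\<kappa> j))"
    by (intro sum.cong refl) simp
  also have "\<dots> = (\<Sum>j\<in>J. ?b (\<kappa> j) * s (\<kappa> j))"
    by (rule sum.group) (use J in auto)
  also have "\<dots> = (\<Sum>i<n. \<Sum>j\<in>J. B $$ (l, i) * vs ! \<kappa> j $ i * s (\<kappa> j))"
    by (simp add: sum_distrib_right) (rule sum.swap)
  also have "\<dots> = (\<Sum>i<n. B $$ (l, i) * (\<Sum>j\<in>J. s (\<kappa> j) * vs ! \<kappa> j $ i))"
    by (simp add: sum_distrib_left ac_simps)
  also have "\<dots> = (B *\<^sub>v vec n (\<lambda>i. \<Sum>j\<in>J. s (\<kappa> j) * vs ! \<kappa> j $ i)) $ l"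
    using l B by (simp add: scalar_prod_def atLeast0LessThan)
  finally show "(mat_of_cols p (map ((*\<^sub>v) B) vs) *\<^sub>v
      vec (length vs) (\<lambda>k. s k * int (card {j \<in> J. \<kappa> j = k}))) $ l =
      (B *\<^sub>v vec n (\<lambda>i. \<Sum>j\<in>J. s (\<kappa> j) * vs ! \<kappa> j $ i)) $ l" .
qed (use B in simp)

section \<open>From Graver elements to indispensable moves\<close>

lemma graver_element_gives_move:
  fixes A B :: "int mat" and vs :: "int vec list"
  assumes A: "A \<in> carrier_mat d n" and B: "B \<in> carrier_mat p n"
    and vs: "set vs \<subseteq> semi_conformal_indec A"
    and w: "w \<in> graver_basis (mat_of_cols p (map ((*\<^sub>v) B) vs))"
  shows "\<exists>x \<in> semi_conformal_indec (lambda_mat A B (l1_norm w)). row_type (l1_norm w) n x = l1_norm w"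
proof -
  define M where "M = mat_of_cols p (map ((*\<^sub>v) B) vs)"
  define r where "r = l1_norm w"
  let ?L = "length vs"
  let ?\<Lambda> = "lambda_mat A B r"
  have dims: "dim_col A = n" "dim_row M = p" "dim_col M = ?L" "dim_col ?\<Lambda> = r * n"
    using A by (auto simp: M_def lambda_mat_def Let_def)
  have wk: "w \<in> mat_kernel M" "w \<noteq> 0\<^sub>v ?L" and wc: "w \<in> carrier_vec ?L" and w0: "M *\<^sub>v w = 0\<^sub>v p"
    using w dims by (auto simp: M_def[symmetric] graver_basis_def mat_kernel_def)
  have w_indec: "\<not> conformal_decomposition M w v v'" for v v'
    using w by (auto simp: graver_basis_def M_def)
  have vsc: "set vs \<subseteq> carrier_vec n"
    using vs dims by (auto simp: semi_conformal_indec_def mat_kernel_def)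
  have "int r = int (\<Sum>k<?L. nat \<bar>w $ k\<bar>)"
    using wc unfolding r_def int_l1_norm by simp
  then have r: "r = (\<Sum>k<?L. nat \<bar>w $ k\<bar>)" by (simp only: of_nat_eq_iff)
  obtain \<kappa> where "(\<forall>j<r. \<kappa> j \<in> {..<?L}) \<and>
      (\<forall>k\<in>{..<?L}. card {j. j < r \<and> \<kappa> j = k} = nat \<bar>w $ k\<bar>)"
    using exists_map_with_multiplicities[of "{..<?L}" "\<lambda>k. nat \<bar>w $ k\<bar>", folded r] by auto
  then have \<kappa>: "\<And>j. j < r \<Longrightarrow> \<kappa> j < ?L"
    and \<kappa>_card: "\<And>k. k < ?L \<Longrightarrow> card {j. j < r \<and> \<kappa> j = k} = nat \<bar>w $ k\<bar>"
    by auto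
  \<comment> \<open>Row \<open>j\<close> itself lies in the class counted by
    \<open>\<bar>w $ \<kappa> j\<bar>\<close>. So the \<open>else\<close> branch in the definition
    of \<open>y\<close> below is exactly the negative case.\<close>
  have w\<kappa>: "w $ \<kappa> j \<noteq> 0" if "j < r" for j
  proof -
    have "j \<in> {j'. j' < r \<and> \<kappa> j' = \<kappa> j}" using that by simp
    moreover have "finite {j'. j' < r \<and> \<kappa> j' = \<kappa> j}" by simp
    ultimately have "card {j'. j' < r \<and> \<kappa> j' = \<kappa> j} \<noteq> 0" by auto
    then show ?thesis using \<kappa>_card[OF \<kappa>[OF that]] by auto
  qed
  define s where "s k = sgn (w $ k)" for k
  define y where "y j = (if w $ \<kappa> j > 0 then vs ! \<kappa> j else - (vs ! \<kappa> j))" for j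
  define x where "x = vec (r * n) (\<lambda>c. y (c div n) $ (c mod n))"
  have yS: "y j \<in> semi_conformal_indec A" if "j < r" for j
    using vs semi_conformal_indec_uminus nth_mem[OF \<kappa>[OF that]] by (auto simp: y_def)
  have yk: "y j \<in> mat_kernel A" "y j \<noteq> 0\<^sub>v n" "y j \<in> carrier_vec n" "A *\<^sub>v y j = 0\<^sub>v d" if "j < r" for j
    using yS[OF that] dims A by (auto simp: semi_conformal_indec_def mat_kernel_def)
  have yi: "y j $ i = s (\<kappa> j) * vs ! \<kappa> j $ i" if "j < r" "i < n" for i j
  proof -
    have "vs ! \<kappa> j \<in> carrier_vec n" using vsc nth_mem[OF \<kappa>[OF that(1)]] by blast
    then show ?thesis using w\<kappa>[OF that(1)] that(2) by (auto simp: y_def s_def sgn_if)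
  qed
  have xc: "x \<in> carrier_vec (r * n)" by (simp add: x_def)
  have rx: "row (as_rows r n x) j = y j" if "j < r" for j
    unfolding x_def by (rule row_as_rows_vec[OF that yk(3)])
  have as_rows_index: "as_rows r n v $$ (j, i) = row (as_rows r n v) j $ i" if "j < r" "i < n" for v j i
    using that by (simp add: as_rows_def)
  \<comment> \<open>Signed counts of the rows selected by \<open>J\<close>. Selecting all rows gives
    back \<open>w\<close>, since \<open>sgn (w $ k) * \<bar>w $ k\<bar> = w $ k\<close>; selecting
    the rows taken by a summand will give the conformal part of \<open>w\<close>.\<close>
  define c where "c J k = s k * int (card {j \<in> J. \<kappa> j = k})" for J k
  have comb: "M *\<^sub>v vec ?L (c J) = B *\<^sub>v vec n (\<lambda>i. \<Sum>j\<in>J. y j $ i)" if J: "J \<subseteq> {..<r}" for J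
  proof -
    have "vec n (\<lambda>i. \<Sum>j\<in>J. y j $ i) = vec n (\<lambda>i. \<Sum>j\<in>J. s (\<kappa> j) * vs ! \<kappa> j $ i)"
      using J yi by (intro eq_vecI) (auto intro!: sum.cong)
    moreover have "finite J" using J by (rule finite_subset) simp
    moreover have "\<kappa> j < ?L" if "j \<in> J" for j using \<kappa> J that by blast
    ultimately show ?thesis
      using row_combination_mult_mat_vec[OF B vsc, of J \<kappa> s]
      unfolding M_def c_def[abs_def] by simp
  qed
  have c_full: "vec ?L (c {..<r}) = w"
    using \<kappa>_card wc by (intro eq_vecI) (auto simp: c_def s_def sgn_mult_abs)
  have xk: "x \<in> mat_kernel ?\<Lambda>"
  proof -
    have "vec n (\<lambda>i. \<Sum>j<r. as_rows r n x $$ (j, i)) = vec n (\<lambda>i. \<Sum>j<r. y j $ i)"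
      using rx as_rows_index by (intro eq_vecI) auto
    then have "B *\<^sub>v vec n (\<lambda>i. \<Sum>j<r. as_rows r n x $$ (j, i)) = 0\<^sub>v p"
      using comb[of "{..<r}"] c_full w0 by simp
    then show ?thesis using mat_kernel_lambda_mat[OF A B] xc rx yk by simp
  qed
  have "r \<noteq> 0"
  proof
    assume "r = 0"
    then have "\<forall>k<?L. w $ k = 0" unfolding r by auto
    then show False using wk(2) wc by (auto simp: vec_eq_iff)
  qed
  then have r0: "0 < r" by simp
  have xn: "x \<noteq> 0\<^sub>v (r * n)"
  proof
    assume "x = 0\<^sub>v (r * n)"
    then have "row (as_rows r n x) 0 = 0\<^sub>v n"
      using r0 less_le_trans[of _ n "r * n"] by (intro eq_vecI) (simp_all add: as_rows_def)
    then show False using rx[OF r0] yk(2)[OF r0] by simp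
  qed
  have no_decomposition: False if dec: "semi_conformal_decomposition ?\<Lambda> x v v'" for v v'
  proof -
    have vk: "v \<in> mat_kernel ?\<Lambda>" "v' \<in> mat_kernel ?\<Lambda>" "v \<noteq> 0\<^sub>v (r * n)" "v' \<noteq> 0\<^sub>v (r * n)"
      and xv: "x = v + v'"
      and sc: "\<And>i. i < r * n \<Longrightarrow> (v $ i > 0 \<longrightarrow> v $ i \<le> x $ i) \<and> (v' $ i < 0 \<longrightarrow> x $ i \<le> v' $ i)"
      using dec by (auto simp: semi_conformal_decomposition_def dims)
    have vc: "v \<in> carrier_vec (r * n)" "v' \<in> carrier_vec (r * n)"
      and vA: "\<And>j. j < r \<Longrightarrow> A *\<^sub>v row (as_rows r n v) j = 0\<^sub>v d"
        "\<And>j. j < r \<Longrightarrow> A *\<^sub>v row (as_rows r n v') j = 0\<^sub>v d"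
      and vB: "B *\<^sub>v vec n (\<lambda>i. \<Sum>j<r. as_rows r n v $$ (j, i)) = 0\<^sub>v p"
      using vk(1,2) mat_kernel_lambda_mat[OF A B] by auto
    have rc: "row (as_rows r n v) j \<in> carrier_vec n" for v j
      by (intro carrier_vecI) (simp add: as_rows_def)
    have rsum: "y j = row (as_rows r n v) j + row (as_rows r n v') j" if "j < r" for j
      using row_as_rows_add[OF that vc] rx[OF that] xv by simp
    \<comment> \<open>Semi-conformality is a coordinatewise condition and so passes to each row; two
      nonzero parts would decompose \<open>y j\<close>.\<close>
    have split: "row (as_rows r n v) j = 0\<^sub>v n \<or> row (as_rows r n v') j = 0\<^sub>v n" if j: "j < r" for j
    proof (rule ccontr)
      assume nz: "\<not> ?thesis"
      have "semi_conformal_decomposition A (y j) (row (as_rows r n v) j) (row (as_rows r n v') j)"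
        unfolding semi_conformal_decomposition_def dims
      proof (intro conjI allI)
        show "{y j, row (as_rows r n v) j, row (as_rows r n v') j} \<subseteq> mat_kernel A - {0\<^sub>v n}"
          using nz yk[OF j] vA[OF j] rc A by (auto simp: mat_kernel_def)
        show "y j = row (as_rows r n v) j + row (as_rows r n v') j" by (rule rsum[OF j])
        fix i
        show "i < n \<longrightarrow> (0 < row (as_rows r n v) j $ i \<longrightarrow> row (as_rows r n v) j $ i \<le> y j $ i) \<and>
          (row (as_rows r n v') j $ i < 0 \<longrightarrow> y j $ i \<le> row (as_rows r n v') j $ i)"
        proof
          assume i: "i < n"
          have "j * n + i < Suc j * n" using i by simp
          also have "\<dots> \<le> r * n" using j by (intro mult_right_mono) auto
          finally show "(0 < row (as_rows r n v) j $ i \<longrightarrow> row (as_rows r n v) j $ i \<le> y j $ i) \<and>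
            (row (as_rows r n v') j $ i < 0 \<longrightarrow> y j $ i \<le> row (as_rows r n v') j $ i)"
            using sc[of "j * n + i"] i j unfolding rx[OF j, symmetric] by (simp add: as_rows_def)
        qed
      qed
      then show False using yS[OF j] by (auto simp: semi_conformal_indec_def)
    qed
    \<comment> \<open>By \<open>split\<close>, the rows in \<open>J\<close> lie entirely in
      \<open>v\<close> and all other rows lie entirely in \<open>v'\<close>.\<close>
    define J where "J = {j. j < r \<and> row (as_rows r n v') j = 0\<^sub>v n}"
    have Jr: "J \<subseteq> {..<r}" by (auto simp: J_def)
    have rJ: "row (as_rows r n v) j = (if j \<in> J then y j else 0\<^sub>v n)" if "j < r" for j
      using split[OF that] rsum[OF that] that rc[of v j] by (auto simp: J_def)
    have "vec n (\<lambda>i. \<Sum>j<r. as_rows r n v $$ (j, i)) = vec n (\<lambda>i. \<Sum>j\<in>J. y j $ i)"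
    proof (rule eq_vecI)
      fix i assume "i < dim_vec (vec n (\<lambda>i. \<Sum>j\<in>J. y j $ i))"
      then have i: "i < n" by simp
      have "(\<Sum>j<r. as_rows r n v $$ (j, i)) = (\<Sum>j<r. if j \<in> J then y j $ i else 0)"
        using rJ as_rows_index[of _ i v] i by (intro sum.cong) auto
      also have "\<dots> = (\<Sum>j\<in>J. y j $ i)"
        using Jr by (simp add: sum.inter_restrict[symmetric] Int_absorb1)
      finally show "vec n (\<lambda>i. \<Sum>j<r. as_rows r n v $$ (j, i)) $ i = vec n (\<lambda>i. \<Sum>j\<in>J. y j $ i) $ i"
        using i by simp
    qed simp
    then have c0: "M *\<^sub>v vec ?L (c J) = 0\<^sub>v p" using comb[OF Jr] vB by simp
    define w' where "w' = vec ?L (c J)"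
    have w'c: "w' \<in> carrier_vec ?L" by (simp add: w'_def)
    have w'k: "w' \<in> mat_kernel M" using c0 dims by (auto simp: mat_kernel_def w'_def)
    have fin: "finite {j. j < r \<and> \<kappa> j = k}" for k by simp
    have sub: "{j \<in> J. \<kappa> j = k} \<subseteq> {j. j < r \<and> \<kappa> j = k}" for k using Jr by auto
    have le: "int (card {j \<in> J. \<kappa> j = k}) \<le> \<bar>w $ k\<bar>" if "k < ?L" for k
      using card_mono[OF fin sub, of k] \<kappa>_card[OF that] by simp
    have w'i: "w' $ k = sgn (w $ k) * int (card {j \<in> J. \<kappa> j = k})" if "k < ?L" for k
      using that by (simp add: w'_def c_def s_def)
    have w'0: "w' \<noteq> 0\<^sub>v ?L"
    proof
      assume z: "w' = 0\<^sub>v ?L"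
      \<comment> \<open>A nonzero row of \<open>v\<close> belongs to \<open>J\<close>, so the
        coordinate of \<open>w'\<close> at \<open>\<kappa> j\<close> counts at least one
        row.\<close>
      obtain j where j: "j < r" "row (as_rows r n v) j \<noteq> 0\<^sub>v n"
        using nonzero_row_exists[OF vc(1) vk(3)] by blast
      then have "j \<in> J" using rJ by (auto split: if_splits)
      then have "card {j' \<in> J. \<kappa> j' = \<kappa> j} \<noteq> 0"
        using finite_subset[OF Jr] by auto
      then show False using w'i[OF \<kappa>[OF j(1)]] w\<kappa>[OF j(1)] \<kappa>[OF j(1)] by (simp add: z sgn_eq_0_iff)
    qed
    have w'w: "w \<noteq> w'"
    proof
      assume z: "w = w'"
      obtain j where j: "j < r" "row (as_rows r n v') j \<noteq> 0\<^sub>v n"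
        using nonzero_row_exists[OF vc(2) vk(4)] by blast
      \<comment> \<open>A nonzero row of \<open>v'\<close> is missing from \<open>J\<close>, so
        \<open>w'\<close> falls strictly short of \<open>w\<close> in absolute value at
        \<open>\<kappa> j\<close>.\<close>
      have "{j' \<in> J. \<kappa> j' = \<kappa> j} \<subset> {j'. j' < r \<and> \<kappa> j' = \<kappa> j}"
        using sub[of "\<kappa> j"] j by (auto simp: J_def)
      then have "card {j' \<in> J. \<kappa> j' = \<kappa> j} < nat \<bar>w $ \<kappa> j\<bar>"
        using psubset_card_mono[OF fin] \<kappa>_card[OF \<kappa>[OF j(1)]] by metis
      moreover have "\<bar>w $ \<kappa> j\<bar> = int (card {j' \<in> J. \<kappa> j' = \<kappa> j})"
        using w'i[OF \<kappa>[OF j(1)]] w\<kappa>[OF j(1)] z by (metis abs_mult abs_of_nat abs_sgn_eq mult_1)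
      ultimately show False by simp
    qed
    \<comment> \<open>Each coordinate of \<open>w'\<close> carries the sign of \<open>w\<close> and
      counts only some of its rows; this is conformality for \<open>w'\<close> and hence also for
      \<open>w - w'\<close>.\<close>
    have w'_le: "(0 \<le> w $ k \<longrightarrow> 0 \<le> w' $ k \<and> w' $ k \<le> w $ k) \<and>
        (w $ k \<le> 0 \<longrightarrow> w $ k \<le> w' $ k \<and> w' $ k \<le> 0)" if "k < ?L" for k
      using le[OF that] unfolding w'i[OF that] by (auto simp: sgn_if)
    have "conformal_decomposition M w w' (w - w')"
      unfolding conformal_decomposition_def dims
    proof (intro conjI allI impI)
      show "{w, w', w - w'} \<subseteq> mat_kernel M - {0\<^sub>v ?L}"
        using wk w'k w'0 w'w mat_kernel_minus[OF wk(1) w'k] minus_eq_zero_vec_iff[OF wc w'c] by auto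
      show "w = w' + (w - w')" using wc w'c by auto
    qed (use w'_le wc w'c in \<open>auto\<close>)
    then show False using w_indec by blast
  qed
  have "x \<in> semi_conformal_indec ?\<Lambda>"
    using xk xn no_decomposition dims by (auto simp: semi_conformal_indec_def)
  moreover have "row_type r n x = r"
  proof -
    have "{j. j < r \<and> row (as_rows r n x) j \<noteq> 0\<^sub>v n} = {..<r}" using rx yk(2) by auto
    then show ?thesis by (simp add: row_type_def)
  qed
  ultimately show ?thesis unfolding r_def by blast
qed

theorem theorem3p11:
  fixes A B :: "int mat" and d n p :: nat and vs :: "int vec list"
  assumes "A \<in> carrier_mat d n" and "\<forall>i<d. \<forall>j<n. 0 \<le> A $$ (i, j)"
    and "\<forall>j<n. col A j \<noteq> 0\<^sub>v d"
    and "B \<in> carrier_mat p n" and "\<forall>i<p. \<forall>j<n. 0 \<le> B $$ (i, j)"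
    and "distinct vs" and "set vs = semi_conformal_indec A"
  shows "enat (Max (insert 0 (l1_norm ` graver_basis (mat_of_cols p (map ((*\<^sub>v) B) vs)))))
           \<le> markov_complexity A B"
proof -
  let ?G = "graver_basis (mat_of_cols p (map ((*\<^sub>v) B) vs))"
  have "enat (l1_norm w) \<le> markov_complexity A B" if w: "w \<in> ?G" for w
  \<comment> \<open>The complexity ranges over \<open>r \<ge> 1\<close>, so
    \<open>r = l1_norm w\<close> is an admissible choice only for positive norm; norm 0 gives the
    trivial bound.\<close>
  proof (cases "l1_norm w = 0")
    case True
    then show ?thesis by (simp add: zero_enat_def[symmetric])
  next
    case False
    obtain x where x: "x \<in> semi_conformal_indec (lambda_mat A B (l1_norm w))"
        "row_type (l1_norm w) n x = l1_norm w"
      using graver_element_gives_move[OF assms(1,4) _ w] assms(7) by auto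
    have "dim_col A = n" using assms(1) by simp
    then show ?thesis
      unfolding markov_complexity_def
      using x False semi_conformal_indec_subset_universal
      by (intro Sup_upper) (force intro!: exI[of _ "l1_norm w"] exI[of _ x])
  qed
  \<comment> \<open>The maximum is attained because the Graver basis is finite; the inserted 0 is
    its value when that basis is empty.\<close>
  moreover have "Max (insert 0 (l1_norm ` ?G)) \<in> insert 0 (l1_norm ` ?G)"
    by (rule Max_in) (simp_all add: finite_graver_basis)
  ultimately show ?thesis by (auto simp: zero_enat_def[symmetric])
qed

end
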